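(* Let $\Pi=\{\pi_1,\pi_2,\ldots,\pi_\ell\}$ be a partition of $[n]=\{1,\ldots,n\}$ with $n\in\pi_\ell$, and let $C=(c_{ij})$ be an $n\times n$ nonnegative matrix with row-sums $r_1\ge r_2\ge\cdots\ge r_n$. For $1\le a\le\ell$ and $1\le b\le\ell-1$, choose $r''_a$, $c''_{ab}$ such that - $r''_a=\max_{i\in\pi_a}r_i$; - $c''_{ab}\ge\sum_{j\in\pi_b}c_{ij}$ for all $i\in\pi_a$; - $c''_{ab}\ge c''_{\ell b}>0$ for $a\ne b$; and let $c''_{a\ell}=r''_a-\sum_{j=1}^{\ell-1}c''_{aj}$. Then the $\ell\times\ell$ matrix $C''=(c''_{ab})$ has a positive rooted eigenvector $v''=(v''_1,v''_2,\ldots,v''_\ell)^T$ for $\rho_r(C'')$, and $\rho(C)\le\rho_r(C'')$. Moreover, if $C$ is irreducible, then $\rho(C)=\rho_r(C'')$ if and only if (a) $r_i=r''_a$ for $1\le a\le\ell$ and $i\in\pi_a$, and (b) $\sum_{j\in\pi_b}c_{ij}=c''_{ab}$ for all $1\le a,b\le\ell$ with $v''_b>v''_\ell$ and $i\in\pi_a$.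
   Context: All matrices are real. $\rho(C)$ is the spectral radius of $C$; $\rho_r(C'')$ is the largest real eigenvalue of $C''$. A column vector $(v_1,\ldots,v_\ell)^T$ is called rooted if $v_j\ge v_\ell\ge0$ for $1\le j\le\ell-1$. The row-sums of $C$ are $r_i=\sum_{j=1}^n c_{ij}$. "Eigenvector" means right eigenvector; positive means entrywise positive.
   Formalization: The formal theorem adds the hypothesis r''_a ≥ r''_ℓ for all a, which n∈π_ℓ and r_1≥…≥r_n do not imply; without it, C with rows (10,0,0),(1,0,0),(1,0,0), π_1={2}, π_2={1,3}, c''_11=0, c''_21=10 is a counterexample. *)

theory Defs
  imports
    "Jordan_Normal_Form.Spectral_Radius"
    "HOL-Library.Disjoint_Sets"
    "HOL-Combinatorics.Permutations"
begin

text \<open>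
  Matrix and vector indices start at 0. Thus $[n]$ is \<open>{..<n}\<close>, its largest element $n$ is \<open>n - 1\<close>,
  the parts $\pi_1, \ldots, \pi_\ell$ are \<open>\<pi> 0, \<dots>, \<pi> (l - 1)\<close>, and $\pi_\ell$ is \<open>\<pi> (l - 1)\<close>.
\<close>

definition row_sum :: "real mat \<Rightarrow> nat \<Rightarrow> real" where
  "row_sum A i = (\<Sum>j<dim_col A. A $$ (i, j))"

text \<open>
  The library's \<^const>\<open>spectral_radius\<close> takes a complex matrix, so that all complex eigenvalues count.
\<close>

definition real_spectral_radius :: "real mat \<Rightarrow> real" where
  "real_spectral_radius A = spectral_radius (map_mat complex_of_real A)"

text \<open>
  Here \<^term>\<open>spectrum A\<close> is the set of real eigenvalues. The \<^const>\<open>Max\<close> is meaningful only if that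
  set is nonempty, i.e. if some real eigenvalue exists.
\<close>

definition largest_real_eigenvalue :: "real mat \<Rightarrow> real" where
  "largest_real_eigenvalue A = Max (spectrum A)"

definition positive_vec :: "real vec \<Rightarrow> bool" where
  "positive_vec v \<longleftrightarrow> (\<forall>i<dim_vec v. 0 < v $ i)"

definition rooted_vec :: "real vec \<Rightarrow> bool" where
  "rooted_vec v \<longleftrightarrow>
     (\<forall>j<dim_vec v - 1. v $ j \<ge> v $ (dim_vec v - 1)) \<and> v $ (dim_vec v - 1) \<ge> 0"

text \<open>
  A square matrix is reducible if a simultaneous permutation of its rows and columns brings it to
  block upper triangular form, with a zero block in rows $k, \ldots, n - 1$ and columns
  $0, \ldots, k - 1$, where $0 < k < n$. Every $1 \times 1$ matrix, also the zero matrix, is irreducible.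
\<close>

definition reducible_mat :: "real mat \<Rightarrow> bool" where
  "reducible_mat A \<longleftrightarrow>
     (\<exists>p k. p permutes {..<dim_row A} \<and> 0 < k \<and> k < dim_row A \<and>
        (\<forall>i\<in>{k..<dim_row A}. \<forall>j<k. A $$ (p i, p j) = 0))"

definition irreducible_mat :: "real mat \<Rightarrow> bool" where
  "irreducible_mat A \<longleftrightarrow> square_mat A \<and> \<not> reducible_mat A"

text \<open>
  The inequalities $r''_a \ge r''_\ell$ have to be assumed separately. They do not follow from
  $r_1 \ge \cdots \ge r_n$ and $n \in \pi_\ell$ when $r''_a$ is the maximum of the row sums over $\pi_a$,
  and without them $C''$ need not have a positive rooted eigenvector, nor need $\rho(C) \le \rho_r(C'')$
  hold. Example: let $C$ have rows $(10,0,0)$, $(1,0,0)$, $(1,0,0)$, let $\pi_1 = \{2\}$,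
  $\pi_2 = \{1,3\}$, and let $c''_{11} = 0$, $c''_{21} = 10$. Then $r'' = (1, 10)$ and $C''$ has rows $(0,1)$,
  $(10,0)$, so that $\rho_r(C'') = \sqrt{10} < 10 = \rho(C)$, with eigenvector $(1, \sqrt{10})$.
\<close>

end

theory Submission
  imports Defs "HOL-Analysis.Function_Topology"
begin

text \<open>
  Conjugating \<open>C''\<close> by the change of basis \<open>v\<^sub>a = u\<^sub>a + u\<^sub>\<ell>\<close> (\<open>a < \<ell>\<close>), \<open>v\<^sub>\<ell> = u\<^sub>\<ell>\<close> gives a matrix that is
  nonnegative off the diagonal. By Perron--Frobenius its largest real eigenvalue \<open>\<lambda>\<close> has a nonnegative
  eigenvector \<open>u\<close>, hence \<open>C''\<close> has a rooted eigenvector \<open>v\<close>; it is positive because the entries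
  \<open>c''\<^sub>\<ell>\<^sub>b\<close> are. Lift \<open>v\<close> to \<open>x\<close> with \<open>x\<^sub>i = v\<^sub>a\<close> for \<open>i \<in> \<pi>\<^sub>a\<close>. Writing \<open>(C x)\<^sub>i\<close> and \<open>\<lambda> x\<^sub>i\<close> in terms of
  the nonnegative numbers \<open>v\<^sub>b - v\<^sub>\<ell>\<close> and \<open>v\<^sub>\<ell>\<close> shows \<open>C x \<le> \<lambda> x\<close>, with equality exactly under (a) and (b).
  If \<open>z\<close> is an eigenvector of \<open>C\<close> for an eigenvalue of modulus \<open>\<rho>(C)\<close>, comparing at an index where
  \<open>|z\<^sub>i| / x\<^sub>i\<close> is maximal gives \<open>\<rho>(C) \<le> \<lambda>\<close>; in the case of equality the set of all such indices is closed
  under the graph of \<open>C\<close>, so for irreducible \<open>C\<close> it contains every index and \<open>C x = \<lambda> x\<close>.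
\<close>

section \<open>The standard simplex as a compact set of functions\<close>

text \<open>Functions vanishing from \<open>l\<close> on stand in for vectors, so that the simplex
  lies in a product of compact sets and Tychonoff's theorem applies.\<close>

definition simplex_fun :: "nat \<Rightarrow> (nat \<Rightarrow> real) set" where
  "simplex_fun l = {x \<in> Pi\<^sub>E UNIV (\<lambda>i. if i < l then {0..1} else {0}). (\<Sum>i<l. x i) = 1}"

lemma simplex_funI:
  assumes "\<And>i. i < l \<Longrightarrow> 0 \<le> x i" "\<And>i. l \<le> i \<Longrightarrow> x i = 0" "(\<Sum>i<l. x i) = 1"
  shows "x \<in> simplex_fun l"
proof -
  have "x i \<le> 1" if "i < l" for i
    using that assms member_le_sum[of i "{..<l}" x] by auto
  with assms show ?thesis
    by (auto simp: simplex_fun_def)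
qed

lemma simplex_funD:
  assumes "x \<in> simplex_fun l"
  shows "0 \<le> x i" "x i \<le> 1" "(\<Sum>i<l. x i) = 1"
proof -
  have "x i \<in> (if i < l then {0..1} else {0})"
    using assms unfolding simplex_fun_def by blast
  then show "0 \<le> x i" "x i \<le> 1" by (auto split: if_splits)
  show "(\<Sum>i<l. x i) = 1"
    using assms by (auto simp: simplex_fun_def)
qed

lemma compact_simplex_fun: "compact (simplex_fun l)"
proof -
  let ?P = "Pi\<^sub>E UNIV (\<lambda>i. if i < l then {0..1::real} else {0})"
  have "compactin (product_topology (\<lambda>i. euclidean) UNIV) ?P"
    unfolding compactin_PiE by auto
  then have "compact ?P"
    by (simp add: euclidean_product_topology)
  moreover have "closed {x::nat \<Rightarrow> real. (\<Sum>i<l. x i) = 1}"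
    by (intro closed_Collect_eq continuous_intros continuous_on_product_then_coordinatewise)
  moreover have "simplex_fun l = ?P \<inter> {x. (\<Sum>i<l. x i) = 1}"
    by (auto simp: simplex_fun_def)
  ultimately show ?thesis
    by (metis compact_Int_closed)
qed

section \<open>Ratio comparison and Perron--Frobenius theory\<close>

text \<open>For \<open>m\<close> the largest ratio \<open>w i / x i\<close>, the vector
  \<open>m * x\<close> dominates \<open>w\<close> and touches it somewhere; the comparison arguments
  take place at such an index.\<close>

lemma exists_max_ratio:
  fixes w x :: "nat \<Rightarrow> real"
  assumes x: "\<And>i. i < n \<Longrightarrow> 0 < x i"
    and w: "\<And>i. i < n \<Longrightarrow> 0 \<le> w i" "i0 < n" "w i0 \<noteq> 0"
  obtains m where "0 < m" "\<And>i. i < n \<Longrightarrow> w i \<le> m * x i" "\<exists>i<n. w i = m * x i"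
proof -
  define m where "m = Max ((\<lambda>i. w i / x i) ` {..<n})"
  have le: "w i / x i \<le> m" if "i < n" for i
    unfolding m_def using that by (intro Max_ge) auto
  have "m \<in> (\<lambda>i. w i / x i) ` {..<n}"
    unfolding m_def using w(2) by (intro Max_in) auto
  then obtain i where i: "i < n" "m = w i / x i" by auto
  show ?thesis
  proof
    show "0 < m"
      using le[OF w(2)] w(1)[OF w(2)] w(3) x[OF w(2)] by (smt (verit) divide_pos_pos)
    show "w i \<le> m * x i" if "i < n" for i
      using le[OF that] x[OF that] by (simp add: pos_divide_le_eq)
    show "\<exists>i<n. w i = m * x i"
      using i x[OF i(1)] by auto
  qed
qed

text \<open>At an index where \<open>w i / x i\<close> has its largest value \<open>m\<close>,
  monotonicity gives \<open>t * m * x i <= (A w) i <= m * (A x) i <= s * m * x i\<close>, and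
  \<open>m * x i\<close> is positive.\<close>

lemma subinvariance_le:
  fixes A :: "nat \<Rightarrow> nat \<Rightarrow> real"
  assumes A: "\<And>i j. i < n \<Longrightarrow> j < n \<Longrightarrow> 0 \<le> A i j"
    and x: "\<And>i. i < n \<Longrightarrow> 0 < x i" "\<And>i. i < n \<Longrightarrow> (\<Sum>j<n. A i j * x j) \<le> s * x i"
    and w: "\<And>i. i < n \<Longrightarrow> 0 \<le> w i" "i0 < n" "w i0 \<noteq> 0"
      "\<And>i. i < n \<Longrightarrow> t * w i \<le> (\<Sum>j<n. A i j * w j)"
  shows "t \<le> s"
proof -
  obtain m where m: "0 < m" "\<And>i. i < n \<Longrightarrow> w i \<le> m * x i" "\<exists>i<n. w i = m * x i"
    using exists_max_ratio[of n x w i0] x(1) w(1-3) by metis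
  then obtain i where i: "i < n" "w i = m * x i" by auto
  have "t * (m * x i) \<le> (\<Sum>j<n. A i j * w j)"
    using w(4)[OF i(1)] i(2) by simp
  also have "\<dots> \<le> (\<Sum>j<n. A i j * (m * x j))"
    using A m(2) i(1) by (intro sum_mono mult_left_mono) auto
  also have "\<dots> = m * (\<Sum>j<n. A i j * x j)"
    by (simp add: sum_distrib_left mult_ac)
  also have "\<dots> \<le> m * (s * x i)"
    using x(2)[OF i(1)] m(1) by simp
  finally have "t * (m * x i) \<le> s * (m * x i)"
    by (simp add: mult_ac)
  then show ?thesis
    using m(1) x(1)[OF i(1)] by (simp add: mult_le_cancel_right)
qed

text \<open>Collatz--Wielandt: the largest \<open>r\<close> with \<open>r x \<le> A x\<close> on the simplex is an eigenvalue, since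
  applying \<open>A > 0\<close> to a nonzero defect \<open>A x - r x\<close> would make every component strict.\<close>

lemma perron_positive:
  fixes A :: "nat \<Rightarrow> nat \<Rightarrow> real"
  assumes l: "0 < l" and A: "\<And>i j. i < l \<Longrightarrow> j < l \<Longrightarrow> 0 < A i j"
  shows "\<exists>x r. x \<in> simplex_fun l \<and> (\<forall>i<l. 0 < x i) \<and>
    (\<forall>i<l. (\<Sum>j<l. A i j * x j) = r * x i)"
proof -
  \<comment> \<open>\<open>M\<close> bounds every admissible \<open>r\<close>, because the entries
    of \<open>x\<close> are at most 1 and sum to 1; confining \<open>r\<close> to
    \<open>{0..M}\<close> makes \<open>S\<close> compact.\<close>
  define M where "M = (\<Sum>i<l. \<Sum>j<l. A i j)"
  define S where "S = (simplex_fun l \<times> {0..M}) \<inter>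
    {p. \<forall>i<l. snd p * fst p i \<le> (\<Sum>j<l. A i j * fst p j)}"
  have "closed {p :: (nat \<Rightarrow> real) \<times> real. \<forall>i<l. snd p * fst p i \<le> (\<Sum>j<l. A i j * fst p j)}"
    by (intro closed_Collect_all closed_Collect_imp closed_Collect_le open_Collect_const
        continuous_intros continuous_on_product_then_coordinatewise)
  then have "compact S"
    unfolding S_def
    by (intro compact_Int_closed compact_Times compact_simplex_fun compact_Icc)
  moreover have M: "0 \<le> M"
    unfolding M_def using A by (intro sum_nonneg) (auto intro: less_imp_le)
  have "((\<lambda>i. if i = 0 then 1 else 0), 0) \<in> S"
    unfolding S_def using l A M
    by (auto intro!: simplex_funI sum_nonneg mult_nonneg_nonneg simp: less_imp_le)
  then have "S \<noteq> {}" by auto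
  moreover have "continuous_on S snd"
    by (intro continuous_intros)
  ultimately obtain p where p: "p \<in> S" "\<And>q. q \<in> S \<Longrightarrow> snd q \<le> snd p"
    using continuous_attains_sup[of S snd] by blast
  obtain x r where xr: "p = (x, r)" by (cases p)
  have x: "x \<in> simplex_fun l" and r: "0 \<le> r"
    and sub: "\<And>i. i < l \<Longrightarrow> r * x i \<le> (\<Sum>j<l. A i j * x j)"
    using p(1) by (auto simp: S_def xr)
  \<comment> \<open>The inequality is homogeneous, so maximality of \<open>r\<close> extends from
    the simplex to every positive \<open>y\<close>; summing over \<open>i\<close> gives the bound
    \<open>t <= M\<close>.\<close>
  have max: "t \<le> r"
    if y: "\<And>i. i < l \<Longrightarrow> 0 < y i" "\<And>i. i < l \<Longrightarrow> t * y i \<le> (\<Sum>j<l. A i j * y j)" "0 \<le> t"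
    for y t
  proof -
    define s where "s = (\<Sum>i<l. y i)"
    have s: "0 < s" unfolding s_def using y(1) l by (intro sum_pos) auto
    define z where "z i = (if i < l then y i / s else 0)" for i
    have z: "z \<in> simplex_fun l"
      using y(1) s by (intro simplex_funI) (auto simp: z_def s_def sum_divide_distrib[symmetric] less_imp_le)
    have tz: "t * z i \<le> (\<Sum>j<l. A i j * z j)" if "i < l" for i
      using divide_right_mono[OF y(2)[OF that], of s] that s
      by (simp add: z_def sum_divide_distrib)
    have "t = (\<Sum>i<l. t * z i)"
      using simplex_funD(3)[OF z] by (simp add: sum_distrib_left[symmetric])
    also have "\<dots> \<le> (\<Sum>i<l. \<Sum>j<l. A i j * z j)"
      using tz by (intro sum_mono) auto
    also have "\<dots> \<le> M"
      unfolding M_def using A simplex_funD(2)[OF z]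
      by (intro sum_mono) (auto intro!: mult_left_le simp: less_imp_le)
    finally have "(z, t) \<in> S"
      unfolding S_def using z tz y(3) by auto
    from p(2)[OF this] show ?thesis by (simp add: xr)
  qed
  \<comment> \<open>The image \<open>y = A x\<close> is the competitor: if \<open>x\<close> is not
    an eigenvector, \<open>y\<close> satisfies the inequality strictly and hence also for some
    \<open>t > r\<close>.\<close>
  define y where "y i = (\<Sum>j<l. A i j * x j)" for i
  have "\<exists>j<l. x j \<noteq> 0"
    using simplex_funD(3)[OF x] by (metis lessThan_iff sum.neutral zero_neq_one)
  have pos: "0 < (\<Sum>j<l. A i j * e j)"
    if e: "i < l" "\<And>j. j < l \<Longrightarrow> 0 \<le> e j" "\<exists>j<l. e j \<noteq> 0" for i e
  proof -
    obtain j where j: "j < l" "e j \<noteq> 0" using e(3) by blast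
    then have "0 < A i j * e j"
      using e(1) A[of i j] e(2)[of j] by (auto intro!: mult_pos_pos simp: order_less_le)
    then show ?thesis
      using j e(1,2) A by (intro sum_pos2[of _ j]) (auto simp: less_imp_le)
  qed
  have y: "0 < y i" if "i < l" for i
    unfolding y_def using that simplex_funD(1)[OF x] \<open>\<exists>j<l. x j \<noteq> 0\<close> by (intro pos) auto
  have eq: "y i = r * x i" if "i < l" for i
  proof (rule ccontr)
    assume neq: "y i \<noteq> r * x i"
    have "r * y k < (\<Sum>j<l. A k j * y j)" if k: "k < l" for k
    proof -
      have "0 < (\<Sum>j<l. A k j * (y j - r * x j))"
        using k sub neq \<open>i < l\<close> by (intro pos) (auto simp: y_def)
      also have "\<dots> = (\<Sum>j<l. A k j * y j) - r * (\<Sum>j<l. A k j * x j)"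
        by (simp add: algebra_simps sum_subtractf sum_distrib_left)
      finally show ?thesis by (simp add: y_def[of k])
    qed
    then have less: "r < (\<Sum>j<l. A k j * y j) / y k" if "k < l" for k
      using that y[OF that] by (simp add: pos_less_divide_eq)
    define t where "t = Min ((\<lambda>k. (\<Sum>j<l. A k j * y j) / y k) ` {..<l})"
    have "t * y k \<le> (\<Sum>j<l. A k j * y j)" if "k < l" for k
    proof -
      have "t \<le> (\<Sum>j<l. A k j * y j) / y k"
        unfolding t_def using that by (intro Min_le) auto
      then show ?thesis using y[OF that] by (simp add: pos_le_divide_eq)
    qed
    moreover have "r < t"
      unfolding t_def using l less by (subst Min_gr_iff) auto
    ultimately show False
      using max[of y t] y r by fastforce
  qed
  have "0 < x i" if "i < l" for i
    using y[OF that] eq[OF that] r simplex_funD(1)[OF x, of i]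
    by (metis less_eq_real_def mult_zero_right order_less_irrefl)
  then show ?thesis
    using x eq unfolding y_def by blast
qed

text \<open>The pair is a limit of Perron pairs of the positive matrices \<open>A + 1 / (k + 1)\<close>.\<close>

lemma perron_nonnegative:
  fixes A :: "nat \<Rightarrow> nat \<Rightarrow> real"
  assumes l: "0 < l" and A: "\<And>i j. i < l \<Longrightarrow> j < l \<Longrightarrow> 0 \<le> A i j"
  shows "\<exists>x r. x \<in> simplex_fun l \<and> (\<forall>i<l. (\<Sum>j<l. A i j * x j) = r * x i) \<and>
    (\<forall>z t. (\<exists>i<l. z i \<noteq> 0) \<longrightarrow> (\<forall>i<l. (\<Sum>j<l. A i j * z j) = t * z i) \<longrightarrow> t \<le> r)"
proof -
  define B where "B k i j = A i j + 1 / real (Suc k)" for k i j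
  have B: "0 < B k i j" if "i < l" "j < l" for k i j
    using A[OF that] by (auto simp: B_def intro: add_nonneg_pos)
  have "\<forall>k. \<exists>p. fst p \<in> simplex_fun l \<and> (\<forall>i<l. 0 < fst p i) \<and>
      (\<forall>i<l. (\<Sum>j<l. B k i j * fst p j) = snd p * fst p i)"
    using perron_positive[where A = "B k" for k, OF l B] by simp
  from choice[OF this] obtain p where p: "\<And>k. fst (p k) \<in> simplex_fun l"
    "\<And>k i. i < l \<Longrightarrow> 0 < fst (p k) i"
    "\<And>k i. i < l \<Longrightarrow> (\<Sum>j<l. B k i j * fst (p k) j) = snd (p k) * fst (p k) i"
    by blast
  \<comment> \<open>Since \<open>1 / real (Suc k) <= 1\<close>, this bounds the eigenvalues of all
    \<open>B k\<close> at once, so some subsequence of the pairs converges.\<close>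
  define M where "M = (\<Sum>i<l. \<Sum>j<l. A i j + 1)"
  have "snd (p k) \<in> {0..M}" for k
  proof -
    have eq: "snd (p k) = (\<Sum>i<l. \<Sum>j<l. B k i j * fst (p k) j)"
      using simplex_funD(3)[OF p(1)] p(3) by (simp add: sum_distrib_left[symmetric])
    have "\<dots> \<le> (\<Sum>i<l. \<Sum>j<l. B k i j)"
      using B simplex_funD(2)[OF p(1)]
      by (intro sum_mono) (auto intro!: mult_left_le simp: less_imp_le)
    also have "\<dots> \<le> M"
      unfolding M_def B_def by (intro sum_mono) auto
    moreover have "0 \<le> (\<Sum>i<l. \<Sum>j<l. B k i j * fst (p k) j)"
      using B simplex_funD(1)[OF p(1)] by (intro sum_nonneg mult_nonneg_nonneg) (auto simp: less_imp_le)
    ultimately show ?thesis using eq by auto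
  qed
  then have "\<forall>k. p k \<in> simplex_fun l \<times> {0..M}"
    using p(1) by (metis mem_Times_iff)
  moreover have "seq_compact (simplex_fun l \<times> {0..M})"
    by (intro compact_imp_seq_compact compact_Times compact_simplex_fun compact_Icc)
  ultimately obtain q f where q: "q \<in> simplex_fun l \<times> {0..M}" and f: "strict_mono f"
    and lim: "(p \<circ> f) \<longlonglongrightarrow> q"
    unfolding seq_compact_def by metis
  have lim1: "(\<lambda>k. fst (p (f k))) \<longlonglongrightarrow> fst q" and lim2: "(\<lambda>k. snd (p (f k))) \<longlonglongrightarrow> snd q"
    using tendsto_fst[OF lim] tendsto_snd[OF lim] by (simp_all add: o_def)
  have limi: "(\<lambda>k. fst (p (f k)) i) \<longlonglongrightarrow> fst q i" for i
    using continuous_on_tendsto_compose[OF continuous_on_product_coordinates[of i] lim1] by auto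
  have "(\<lambda>k. 1 / real (Suc (f k))) \<longlonglongrightarrow> 0"
    using LIMSEQ_subseq_LIMSEQ[OF LIMSEQ_Suc[OF lim_1_over_n] f] by (simp add: o_def)
  then have limB: "(\<lambda>k. B (f k) i j) \<longlonglongrightarrow> A i j" for i j
    unfolding B_def by (auto intro: tendsto_eq_intros)
  show ?thesis
  proof (rule exI[of _ "fst q"], rule exI[of _ "snd q"], intro conjI allI impI)
    show "fst q \<in> simplex_fun l" using q by auto
    show "(\<Sum>j<l. A i j * fst q j) = snd q * fst q i" if "i < l" for i
    proof (rule LIMSEQ_unique)
      show "(\<lambda>k. \<Sum>j<l. B (f k) i j * fst (p (f k)) j) \<longlonglongrightarrow> (\<Sum>j<l. A i j * fst q j)"
        by (intro tendsto_intros limB limi)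
      show "(\<lambda>k. \<Sum>j<l. B (f k) i j * fst (p (f k)) j) \<longlonglongrightarrow> snd q * fst q i"
        unfolding p(3)[OF that] by (intro tendsto_intros lim2 limi)
    qed
    fix z :: "nat \<Rightarrow> real" and t
    assume "\<exists>i<l. z i \<noteq> 0" "\<forall>i<l. (\<Sum>j<l. A i j * z j) = t * z i"
    then obtain i0 where z: "i0 < l" "z i0 \<noteq> 0" "\<And>i. i < l \<Longrightarrow> (\<Sum>j<l. A i j * z j) = t * z i"
      by blast
    \<comment> \<open>Here \<open>t * |z| <= A |z| <= B k |z|\<close>, and the Perron vector of
      \<open>B k\<close> is strictly positive. Comparing before the limit matters, as the limit
      vector may have zeros.\<close>
    have "t \<le> snd (p k)" for k
    proof (rule subinvariance_le[where A = "B k" and x = "fst (p k)" and w = "\<lambda>i. \<bar>z i\<bar>" and n = l])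
      fix i assume i: "i < l"
      have "t * \<bar>z i\<bar> \<le> \<bar>t * z i\<bar>"
        by (simp add: abs_mult mult_right_mono)
      also have "\<dots> \<le> (\<Sum>j<l. \<bar>A i j * z j\<bar>)"
        using z(3)[OF i] sum_abs by metis
      also have "\<dots> \<le> (\<Sum>j<l. B k i j * \<bar>z j\<bar>)"
        using A i by (intro sum_mono) (auto simp: B_def abs_mult intro!: mult_right_mono)
      finally show "t * \<bar>z i\<bar> \<le> (\<Sum>j<l. B k i j * \<bar>z j\<bar>)" .
    qed (use B p z in \<open>auto simp: less_imp_le\<close>)
    then show "t \<le> snd q"
      using lim2 by (meson LIMSEQ_le_const)
  qed
qed

text \<open>Adding a large enough \<open>d\<close> to the diagonal makes the matrix nonnegative,
  keeps the eigenvectors and shifts every eigenvalue by \<open>d\<close>.\<close>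

lemma perron_metzler:
  fixes A :: "nat \<Rightarrow> nat \<Rightarrow> real"
  assumes l: "0 < l" and A: "\<And>i j. i < l \<Longrightarrow> j < l \<Longrightarrow> i \<noteq> j \<Longrightarrow> 0 \<le> A i j"
  shows "\<exists>x r. x \<in> simplex_fun l \<and> (\<forall>i<l. (\<Sum>j<l. A i j * x j) = r * x i) \<and>
    (\<forall>z t. (\<exists>i<l. z i \<noteq> 0) \<longrightarrow> (\<forall>i<l. (\<Sum>j<l. A i j * z j) = t * z i) \<longrightarrow> t \<le> r)"
proof -
  define d where "d = (\<Sum>i<l. \<bar>A i i\<bar>)"
  define B where "B i j = A i j + (if j = i then d else 0)" for i j
  have "\<bar>A i i\<bar> \<le> d" if "i < l" for i
    unfolding d_def using that by (intro member_le_sum) auto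
  then have B: "0 \<le> B i j" if "i < l" "j < l" for i j
    using that A[OF that] unfolding B_def by (smt (verit))
  have sum_B: "(\<Sum>j<l. B i j * z j) = (\<Sum>j<l. A i j * z j) + d * z i" if "i < l" for i z
    using that by (simp add: B_def distrib_right sum.distrib if_distrib[of "\<lambda>u. u * _"] cong: if_cong)
  obtain x r where x: "x \<in> simplex_fun l" "\<forall>i<l. (\<Sum>j<l. B i j * x j) = r * x i"
    and r: "\<forall>z t. (\<exists>i<l. z i \<noteq> 0) \<longrightarrow> (\<forall>i<l. (\<Sum>j<l. B i j * z j) = t * z i) \<longrightarrow> t \<le> r"
    using perron_nonnegative[where A = B, OF l B] by blast
  have shift: "(\<Sum>j<l. A i j * z j) = t * z i \<longleftrightarrow> (\<Sum>j<l. B i j * z j) = (t + d) * z i"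
    if "i < l" for i z t
    using sum_B[OF that] by (simp add: distrib_right)
  show ?thesis
  proof (rule exI[of _ x], rule exI[of _ "r - d"], intro conjI allI impI)
    fix z :: "nat \<Rightarrow> real" and t
    assume "\<exists>i<l. z i \<noteq> 0" "\<forall>i<l. (\<Sum>j<l. A i j * z j) = t * z i"
    then have "t + d \<le> r"
      using r shift by blast
    then show "t \<le> r - d" by simp
  qed (use x shift in auto)
qed

section \<open>Irreducibility and bounds on the spectral radius\<close>

text \<open>No arc of the graph of \<open>C\<close> leaves \<open>S\<close>. If the complement were
  nonempty, listing it first and \<open>S\<close> last would exhibit the zero block of a reducible
  matrix.\<close>

lemma irreducible_matD:
  assumes irr: "irreducible_mat C" and C: "C \<in> carrier_mat n n"
    and S: "S \<subseteq> {..<n}" "S \<noteq> {}"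
    and zero: "\<And>i j. i \<in> S \<Longrightarrow> j < n \<Longrightarrow> j \<notin> S \<Longrightarrow> C $$ (i, j) = 0"
  shows "S = {..<n}"
proof (rule ccontr)
  assume "S \<noteq> {..<n}"
  define T where "T = {..<n} - S"
  define k where "k = card T"
  have fin: "finite S" "finite T" using S(1) finite_subset by (auto simp: T_def)
  have "T \<noteq> {}" using S(1) \<open>S \<noteq> {..<n}\<close> by (auto simp: T_def)
  then have k0: "0 < k" using fin by (simp add: k_def card_gt_0_iff)
  have "k + card S = card (T \<union> S)"
    unfolding k_def using fin by (subst card_Un_disjoint) (auto simp: T_def)
  also have "T \<union> S = {..<n}" using S(1) by (auto simp: T_def)
  finally have kS: "k + card S = n" by simp
  then have kn: "k < n" using fin S(2) by (metis card_gt_0_iff less_add_same_cancel1)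
  obtain f where f: "bij_betw f {..<k} T"
    using finite_same_card_bij[of "{..<k}" T] fin by (auto simp: k_def)
  obtain g where g: "bij_betw g {k..<n} S"
    using finite_same_card_bij[of "{k..<n}" S] fin kS by auto
  \<comment> \<open>\<open>f\<close> fills the first \<open>k\<close> places with the complement and
    \<open>g\<close> the remaining ones with \<open>S\<close>; the identity from \<open>n\<close> on
    is what \<open>permutes\<close> demands.\<close>
  define p where "p i = (if i < k then f i else if i < n then g i else i)" for i
  have "bij_betw p ({..<k} \<union> {k..<n}) (T \<union> S)"
  proof (rule bij_betw_combine)
    show "bij_betw p {..<k} T"
      using f by (subst bij_betw_cong[of _ _ f]) (auto simp: p_def)
    show "bij_betw p {k..<n} S"
      using g by (subst bij_betw_cong[of _ _ g]) (auto simp: p_def)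
  qed (auto simp: T_def)
  moreover have "{..<k} \<union> {k..<n} = {..<n}" using kn by auto
  ultimately have "p permutes {..<n}"
    using \<open>T \<union> S = {..<n}\<close> by (intro bij_imp_permutes) (auto simp: p_def kn)
  moreover have "C $$ (p i, p j) = 0" if "i \<in> {k..<n}" "j < k" for i j
  proof -
    have "p i \<in> S" using that g by (auto simp: p_def bij_betw_def)
    moreover have "p j \<in> T" using that f by (auto simp: p_def bij_betw_def)
    ultimately show ?thesis using zero by (auto simp: T_def)
  qed
  ultimately have "reducible_mat C"
    using k0 kn C unfolding reducible_mat_def by (auto intro!: exI[of _ p] exI[of _ k])
  then show False using irr by (simp add: irreducible_mat_def)
qed

lemma eigenvector_iff_sum:
  assumes "A \<in> carrier_mat n n"
  shows "eigenvector A v k \<longleftrightarrow>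
    dim_vec v = n \<and> (\<exists>i<n. v $ i \<noteq> 0) \<and> (\<forall>i<n. (\<Sum>j<n. A $$ (i, j) * v $ j) = k * v $ i)"
proof -
  have A: "dim_row A = n" "dim_col A = n"
    using assms by auto
  have "v \<noteq> 0\<^sub>v n \<longleftrightarrow> (\<exists>i<n. v $ i \<noteq> 0)" if "dim_vec v = n"
    unfolding vec_eq_iff using that by simp
  moreover have "A *\<^sub>v v = k \<cdot>\<^sub>v v \<longleftrightarrow> (\<forall>i<n. (\<Sum>j<n. A $$ (i, j) * v $ j) = k * v $ i)"
    if v: "dim_vec v = n"
  proof -
    have "(A *\<^sub>v v) $ i = (\<Sum>j<n. A $$ (i, j) * v $ j)" if "i < n" for i
      using A v that by (simp add: scalar_prod_def atLeast0LessThan)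
    then show ?thesis
      unfolding vec_eq_iff using A v by simp
  qed
  ultimately show ?thesis
    unfolding eigenvector_def carrier_vec_def A by blast
qed

text \<open>The moduli \<open>w\<close> of an eigenvector for an eigenvalue of largest modulus
  satisfy \<open>real_spectral_radius C * w <= C w\<close>, which is compared with the positive
  \<open>x\<close>. For irreducible \<open>C\<close>, equality spreads from one index to
  all.\<close>

lemma positive_subinvariant_vec:
  fixes C :: "real mat"
  assumes C: "C \<in> carrier_mat n n" "\<And>i j. i < n \<Longrightarrow> j < n \<Longrightarrow> 0 \<le> C $$ (i, j)"
    and n: "0 < n"
    and x: "\<And>i. i < n \<Longrightarrow> 0 < x i" "\<And>i. i < n \<Longrightarrow> (\<Sum>j<n. C $$ (i, j) * x j) \<le> s * x i"
  shows real_spectral_radius_le: "real_spectral_radius C \<le> s"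
    and real_spectral_radius_eq_iff: "irreducible_mat C \<Longrightarrow>
      real_spectral_radius C = s \<longleftrightarrow> (\<forall>i<n. (\<Sum>j<n. C $$ (i, j) * x j) = s * x i)"
proof -
  let ?C = "map_mat complex_of_real C"
  let ?r = "real_spectral_radius C"
  have carr: "?C \<in> carrier_mat n n" using C by auto
  note sr = spectral_radius_mem_max[OF carr n, folded real_spectral_radius_def]
  obtain \<mu> where \<mu>: "\<mu> \<in> spectrum ?C" "?r = norm \<mu>" using sr(1) by auto
  then obtain z where "eigenvector ?C z \<mu>"
    by (auto simp: spectrum_def eigenvalue_def)
  then obtain i0 where i0: "i0 < n" "z $ i0 \<noteq> 0"
    and z: "\<And>i. i < n \<Longrightarrow> (\<Sum>j<n. ?C $$ (i, j) * z $ j) = \<mu> * z $ i"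
    unfolding eigenvector_iff_sum[OF carr] by auto
  define w where "w i = norm (z $ i)" for i
  have w: "\<And>i. i < n \<Longrightarrow> 0 \<le> w i" "w i0 \<noteq> 0" using i0 by (auto simp: w_def)
  have sub: "?r * w i \<le> (\<Sum>j<n. C $$ (i, j) * w j)" if i: "i < n" for i
  proof -
    have "?r * w i = norm (\<Sum>j<n. ?C $$ (i, j) * z $ j)"
      using z[OF i] by (simp add: \<mu>(2) w_def norm_mult)
    also have "\<dots> \<le> (\<Sum>j<n. norm (?C $$ (i, j) * z $ j))"
      by (rule norm_sum)
    also have "\<dots> = (\<Sum>j<n. C $$ (i, j) * w j)"
      using C i by (intro sum.cong) (auto simp: norm_mult w_def)
    finally show ?thesis .
  qed
  show le: "?r \<le> s"
    by (rule subinvariance_le[where A = "\<lambda>i j. C $$ (i, j)" and x = x and w = w and n = n])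
      (use C x w i0 sub in auto)
  assume irr: "irreducible_mat C"
  show "?r = s \<longleftrightarrow> (\<forall>i<n. (\<Sum>j<n. C $$ (i, j) * x j) = s * x i)"
  proof
    assume eq: "?r = s"
    obtain m where m: "0 < m" "\<And>i. i < n \<Longrightarrow> w i \<le> m * x i" "\<exists>i<n. w i = m * x i"
      using exists_max_ratio[of n x w i0] x(1) w i0(1) by metis
    define S where "S = {i. i < n \<and> w i = m * x i}"
    \<comment> \<open>For \<open>i\<close> in \<open>S\<close> the chain
      \<open>m * s * x i <= (C w) i <= m * (C x) i <= m * s * x i\<close> collapses to equalities. A
      \<open>j\<close> outside \<open>S\<close> has \<open>w j < m * x j\<close>, so its coefficient
      must vanish.\<close>
    have S: "(\<Sum>j<n. C $$ (i, j) * x j) = s * x i \<and> (\<forall>j<n. j \<notin> S \<longrightarrow> C $$ (i, j) = 0)"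
      if "i \<in> S" for i
    proof -
      have i: "i < n" "w i = m * x i" using that by (auto simp: S_def)
      have "m * (s * x i) \<le> (\<Sum>j<n. C $$ (i, j) * w j)"
        using sub[OF i(1)] by (simp add: eq i(2) mult_ac)
      moreover have "m * (\<Sum>j<n. C $$ (i, j) * x j) \<le> m * (s * x i)"
        using x(2)[OF i(1)] m(1) by simp
      moreover have mono: "C $$ (i, j) * w j \<le> C $$ (i, j) * (m * x j)" if "j < n" for j
        using C(2)[OF i(1) that] m(2)[OF that] by (simp add: mult_left_mono)
      then have "(\<Sum>j<n. C $$ (i, j) * w j) \<le> (\<Sum>j<n. C $$ (i, j) * (m * x j))"
        by (intro sum_mono) auto
      moreover have pull: "(\<Sum>j<n. C $$ (i, j) * (m * x j)) = m * (\<Sum>j<n. C $$ (i, j) * x j)"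
        by (simp add: sum_distrib_left mult_ac)
      ultimately have eqs: "m * (\<Sum>j<n. C $$ (i, j) * x j) = m * (s * x i)"
        "(\<Sum>j<n. C $$ (i, j) * w j) = (\<Sum>j<n. C $$ (i, j) * (m * x j))"
        by linarith+
      have "C $$ (i, j) = 0" if "j < n" "j \<notin> S" for j
      proof -
        have "C $$ (i, j) * w j = C $$ (i, j) * (m * x j)"
          using sum_mono_inv[OF eqs(2)] mono that(1) by auto
        then show ?thesis using that by (auto simp: S_def)
      qed
      with eqs(1) m(1) show ?thesis by auto
    qed
    have "S = {..<n}"
      using S m(3) by (intro irreducible_matD[OF irr C(1)]) (auto simp: S_def)
    with S show "\<forall>i<n. (\<Sum>j<n. C $$ (i, j) * x j) = s * x i" by blast
  next
    assume eq: "\<forall>i<n. (\<Sum>j<n. C $$ (i, j) * x j) = s * x i"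
    \<comment> \<open>Now \<open>x\<close> itself is an eigenvector for \<open>s\<close>, whence
      \<open>|s| <= real_spectral_radius C <= s\<close>.\<close>
    have "eigenvector ?C (vec n (\<lambda>i. complex_of_real (x i))) (complex_of_real s)"
      unfolding eigenvector_iff_sum[OF carr]
    proof (intro conjI allI impI)
      show "\<exists>i<n. vec n (\<lambda>i. complex_of_real (x i)) $ i \<noteq> 0"
        using n x(1)[OF n] by auto
      fix i assume i: "i < n"
      have "(\<Sum>j<n. ?C $$ (i, j) * vec n (\<lambda>i. complex_of_real (x i)) $ j) =
          complex_of_real (\<Sum>j<n. C $$ (i, j) * x j)"
        using C i by (auto intro!: sum.cong)
      then show "(\<Sum>j<n. ?C $$ (i, j) * vec n (\<lambda>i. complex_of_real (x i)) $ j) =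
          complex_of_real s * vec n (\<lambda>i. complex_of_real (x i)) $ i"
        using eq i by simp
    qed simp
    then have "norm (complex_of_real s) \<in> norm ` spectrum ?C"
      unfolding spectrum_def eigenvalue_def by blast
    from sr(2)[OF this] le show "?r = s" by simp
  qed
qed

section \<open>Rooted eigenvectors\<close>

text \<open>For rooted \<open>z\<close> the coefficients \<open>z b - z m\<close> and
  \<open>z m\<close> are nonnegative, and the row sum replaces the last column, whose entries may be
  negative.\<close>

lemma rooted_sum_eq:
  assumes "M \<in> carrier_mat (Suc m) (Suc m)"
  shows "(\<Sum>b<Suc m. M $$ (a, b) * z b) =
    (\<Sum>b<m. M $$ (a, b) * (z b - z m)) + row_sum M a * (z m :: real)"
proof -
  have "row_sum M a = (\<Sum>b<m. M $$ (a, b)) + M $$ (a, m)"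
    using assms by (auto simp: row_sum_def)
  then show ?thesis
    by (simp add: algebra_simps sum_subtractf sum_distrib_left)
qed

text \<open>In the coordinates \<open>(v\<^sub>a - v\<^sub>m, v\<^sub>m)\<close>, which are nonnegative exactly for rooted \<open>v\<close>, the matrix
  \<open>M\<close> becomes \<open>D\<close> below, and \<open>D\<close> is nonnegative off the diagonal.\<close>

lemma rooted_eigenvector_exists:
  fixes M :: "real mat"
  assumes M: "M \<in> carrier_mat (Suc m) (Suc m)"
    and off: "\<And>a b. a < m \<Longrightarrow> b < m \<Longrightarrow> a \<noteq> b \<Longrightarrow> M $$ (m, b) \<le> M $$ (a, b)"
    and last: "\<And>b. b < m \<Longrightarrow> 0 < M $$ (m, b)"
    and row: "\<And>a. a < m \<Longrightarrow> row_sum M m \<le> row_sum M a"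
  shows "\<exists>v. positive_vec v \<and> rooted_vec v \<and> eigenvector M v (largest_real_eigenvalue M)"
proof -
  let ?r = "row_sum M"
  define E where "E u a = (\<Sum>b<m. M $$ (a, b) * u b) + ?r a * u m" for u :: "nat \<Rightarrow> real" and a
  define D where "D a b = (if b < m then M $$ (a, b) else ?r a) -
    (if a < m then (if b < m then M $$ (m, b) else ?r m) else 0)" for a b
  have sum_D: "(\<Sum>b<Suc m. D a b * u b) = E u a - (if a < m then E u m else 0)" for u a
    by (simp add: D_def E_def left_diff_distrib sum_subtractf)
  have "0 \<le> D a b" if "a < Suc m" "b < Suc m" "a \<noteq> b" for a b
    using that off[of a b] last[of b] row[of a] by (auto simp: D_def less_Suc_eq)
  then obtain u s where u: "u \<in> simplex_fun (Suc m)"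
    and eig: "\<forall>a<Suc m. (\<Sum>b<Suc m. D a b * u b) = s * u a"
    and max: "\<forall>z t. (\<exists>a<Suc m. z a \<noteq> 0) \<longrightarrow>
      (\<forall>a<Suc m. (\<Sum>b<Suc m. D a b * z b) = t * z a) \<longrightarrow> t \<le> s"
    using perron_metzler[where A = D, OF zero_less_Suc] by blast
  note u_nonneg = simplex_funD(1)[OF u]
  have E_last: "E u m = s * u m"
    using eig[rule_format, of m] unfolding sum_D by simp
  have E_other: "E u a = s * (u a + u m)" if "a < m" for a
    using eig[rule_format, of a] that E_last unfolding sum_D by (simp add: distrib_left)
  \<comment> \<open>If \<open>u m\<close> were 0, the last row of \<open>M\<close>, positive before
    column \<open>m\<close>, would force every other \<open>u b\<close> to be 0, although the
    entries sum to 1.\<close>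
  have um: "0 < u m"
  proof (rule ccontr)
    assume "\<not> 0 < u m"
    then have 0: "u m = 0" using u_nonneg[of m] by simp
    then have "(\<Sum>b<m. M $$ (m, b) * u b) = 0"
      using E_last by (simp add: E_def)
    then have "M $$ (m, b) * u b = 0" if "b < m" for b
      using that last u_nonneg by (subst (asm) sum_nonneg_eq_0_iff) (auto simp: less_imp_le)
    then have "(\<Sum>b<Suc m. u b) = 0"
      using last 0 by (fastforce intro!: sum.neutral simp: less_Suc_eq)
    then show False using simplex_funD(3)[OF u] by simp
  qed
  define v where "v = vec (Suc m) (\<lambda>a. if a < m then u a + u m else u m)"
  have v: "v $ m = u m" "\<And>a. a < m \<Longrightarrow> v $ a = u a + u m" by (auto simp: v_def)
  have "(\<Sum>b<Suc m. M $$ (a, b) * v $ b) = s * v $ a" if "a < Suc m" for a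
  proof -
    have "(\<Sum>b<Suc m. M $$ (a, b) * v $ b) = E u a"
      unfolding rooted_sum_eq[OF M] by (simp add: v E_def)
    also have "\<dots> = s * v $ a"
      using that E_last E_other by (cases "a = m") (auto simp: v)
    finally show ?thesis .
  qed
  then have ev: "eigenvector M v s"
    unfolding eigenvector_iff_sum[OF M] using um v by (auto simp: v_def intro!: exI[of _ m])
  \<comment> \<open>The inverse change of coordinates turns each real eigenvector of
    \<open>M\<close> into one of \<open>D\<close>, so the maximality of \<open>s\<close> carries
    over to \<open>M\<close>.\<close>
  have "t \<le> s" if "t \<in> spectrum M" for t
  proof -
    obtain w where "eigenvector M w t"
      using \<open>t \<in> spectrum M\<close> by (auto simp: spectrum_def eigenvalue_def)
    then obtain a0 where a0: "a0 < Suc m" "w $ a0 \<noteq> 0"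
      and w: "\<And>a. a < Suc m \<Longrightarrow> (\<Sum>b<Suc m. M $$ (a, b) * w $ b) = t * w $ a"
      unfolding eigenvector_iff_sum[OF M] by metis
    define z where "z a = (if a < m then w $ a - w $ m else w $ m)" for a
    have z: "z m = w $ m" "\<And>a. a < m \<Longrightarrow> z a = w $ a - w $ m"
      by (simp_all add: z_def)
    have E: "E z a = t * w $ a" if "a < Suc m" for a
      using w[OF that] unfolding rooted_sum_eq[OF M] by (simp add: E_def z_def)
    have "(\<Sum>b<Suc m. D a b * z b) = t * z a" if "a < Suc m" for a
      unfolding sum_D using that E by (cases "a = m") (auto simp: z right_diff_distrib)
    moreover have "\<exists>a<Suc m. z a \<noteq> 0"
      using a0 by (cases "w $ m = 0") (auto simp: z less_Suc_eq intro: exI[of _ m])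
    ultimately show ?thesis using max by blast
  qed
  moreover have "s \<in> spectrum M" using ev by (auto simp: spectrum_def eigenvalue_def)
  ultimately have "largest_real_eigenvalue M = s"
    unfolding largest_real_eigenvalue_def
    using card_finite_spectrum(1)[OF M] by (intro Max_eqI) auto
  moreover have "positive_vec v" "rooted_vec v"
    using um u_nonneg by (auto simp: positive_vec_def rooted_vec_def v_def intro: add_nonneg_pos)
  ultimately show ?thesis using ev by blast
qed

section \<open>Comparison of \<open>C\<close> with \<open>C''\<close>\<close>

text \<open>The sums agree only if all terms agree, and a term with \<open>g b = 0\<close> says
  nothing about \<open>c b\<close> and \<open>d b\<close>. With \<open>g b = v $ b - v $ m\<close>
  this is where the restriction on \<open>b\<close> in (b) comes from.\<close>

lemma weighted_sum_le:
  fixes c d g :: "nat \<Rightarrow> real"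
  assumes "\<And>b. b < m \<Longrightarrow> c b \<le> d b" "\<And>b. b < m \<Longrightarrow> 0 \<le> g b" "p \<le> q" "0 < y"
  shows weighted_sum_mono: "(\<Sum>b<m. c b * g b) + p * y \<le> (\<Sum>b<m. d b * g b) + q * y"
    and weighted_sum_eq_iff: "(\<Sum>b<m. c b * g b) + p * y = (\<Sum>b<m. d b * g b) + q * y \<longleftrightarrow>
      p = q \<and> (\<forall>b<m. 0 < g b \<longrightarrow> c b = d b)"
proof -
  have terms: "c b * g b \<le> d b * g b" if "b \<in> {..<m}" for b
    using assms that by (simp add: mult_right_mono)
  have sums: "(\<Sum>b<m. c b * g b) \<le> (\<Sum>b<m. d b * g b)"
    using terms by (rule sum_mono)
  have py: "p * y \<le> q * y" using assms by simp
  show "(\<Sum>b<m. c b * g b) + p * y \<le> (\<Sum>b<m. d b * g b) + q * y"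
    using sums py by simp
  show "(\<Sum>b<m. c b * g b) + p * y = (\<Sum>b<m. d b * g b) + q * y \<longleftrightarrow>
      p = q \<and> (\<forall>b<m. 0 < g b \<longrightarrow> c b = d b)"
  proof
    assume "(\<Sum>b<m. c b * g b) + p * y = (\<Sum>b<m. d b * g b) + q * y"
    then have eqs: "p * y = q * y" "(\<Sum>b<m. c b * g b) = (\<Sum>b<m. d b * g b)"
      using sums py by linarith+
    have "c b * g b = d b * g b" if "b < m" for b
      using sum_mono_inv[OF eqs(2)] terms that by auto
    then have "c b = d b" if "b < m" "0 < g b" for b
      using that by (metis mult_right_cancel order_less_irrefl)
    with eqs(1) assms(4) show "p = q \<and> (\<forall>b<m. 0 < g b \<longrightarrow> c b = d b)" by auto
  next
    assume *: "p = q \<and> (\<forall>b<m. 0 < g b \<longrightarrow> c b = d b)"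
    then have "c b * g b = d b * g b" if "b < m" for b
      using that assms(2)[OF that] by (cases "g b = 0") auto
    then have "(\<Sum>b<m. c b * g b) = (\<Sum>b<m. d b * g b)"
      by (intro sum.cong) auto
    with * show "(\<Sum>b<m. c b * g b) + p * y = (\<Sum>b<m. d b * g b) + q * y" by auto
  qed
qed

theorem theorem9p1:
  fixes n l :: nat
    and \<pi> :: "nat \<Rightarrow> nat set"
    and C C'' :: "real mat"
    and r'' :: "nat \<Rightarrow> real"
  assumes l_pos: "0 < l"
    and partition: "partition_on {..<n} (\<pi> ` {..<l})" "inj_on \<pi> {..<l}"
    and last_in: "n - 1 \<in> \<pi> (l - 1)"
    and C_dim: "C \<in> carrier_mat n n"
    and C_nonneg: "\<And>i j. i < n \<Longrightarrow> j < n \<Longrightarrow> C $$ (i, j) \<ge> 0"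
    and row_sums_decreasing: "\<And>i j. i \<le> j \<Longrightarrow> j < n \<Longrightarrow> row_sum C i \<ge> row_sum C j"
    and C''_dim: "C'' \<in> carrier_mat l l"
    and r''_max: "\<And>a. a < l \<Longrightarrow> r'' a = Max (row_sum C ` \<pi> a)"
    and r''_last: "\<And>a. a < l \<Longrightarrow> r'' a \<ge> r'' (l - 1)"
    and C''_ge: "\<And>a b i. a < l \<Longrightarrow> b < l - 1 \<Longrightarrow> i \<in> \<pi> a \<Longrightarrow> C'' $$ (a, b) \<ge> (\<Sum>j\<in>\<pi> b. C $$ (i, j))"
    and C''_off_diag: "\<And>a b. a < l \<Longrightarrow> b < l - 1 \<Longrightarrow> a \<noteq> b \<Longrightarrow>
          C'' $$ (a, b) \<ge> C'' $$ (l - 1, b) \<and> C'' $$ (l - 1, b) > 0"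
    and C''_last_col: "\<And>a. a < l \<Longrightarrow> C'' $$ (a, l - 1) = r'' a - (\<Sum>j<l - 1. C'' $$ (a, j))"
  shows "(\<exists>v''. positive_vec v'' \<and> rooted_vec v'' \<and> eigenvector C'' v'' (largest_real_eigenvalue C'')) \<and>
    real_spectral_radius C \<le> largest_real_eigenvalue C'' \<and>
    (irreducible_mat C \<longrightarrow>
      (\<forall>v''. positive_vec v'' \<and> rooted_vec v'' \<and> eigenvector C'' v'' (largest_real_eigenvalue C'') \<longrightarrow>
        (real_spectral_radius C = largest_real_eigenvalue C'' \<longleftrightarrow>
          (\<forall>a<l. \<forall>i\<in>\<pi> a. row_sum C i = r'' a) \<and>
          (\<forall>a<l. \<forall>b<l. v'' $ b > v'' $ (l - 1) \<longrightarrow>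
            (\<forall>i\<in>\<pi> a. (\<Sum>j\<in>\<pi> b. C $$ (i, j)) = C'' $$ (a, b))))))"
proof -
  \<comment> \<open>\<open>m\<close> is the index of the last part; for \<open>m = 0\<close> the
    only entry of \<open>C''\<close> is \<open>r'' 0\<close>.\<close>
  obtain m where l: "l = Suc m" using l_pos by (cases l) auto
  let ?s = "largest_real_eigenvalue C''"
  have Un: "(\<Union>b<l. \<pi> b) = {..<n}"
    using partition(1) by (auto simp: partition_on_def)
  have disj: "\<pi> a \<inter> \<pi> b = {}" if "a < l" "b < l" "a \<noteq> b" for a b
  proof -
    have "\<pi> a \<noteq> \<pi> b"
      using partition(2) that by (auto dest: inj_onD)
    then show ?thesis
      using partition(1) that unfolding partition_on_def disjoint_def by blast
  qed
  have part: "i < n" if "a < l" "i \<in> \<pi> a" for a i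
    using Un that by blast
  have fin: "finite (\<pi> a)" if "a < l" for a
    using part[OF that] by (meson finite_nat_set_iff_bounded)
  \<comment> \<open>For \<open>n = 0\<close> the truncated \<open>n - 1\<close> would be 0, yet
    members of a part are below \<open>n\<close>.\<close>
  have n: "0 < n"
    using last_in part[of m "n - 1"] l by simp
  have row_C'': "row_sum C'' a = r'' a" if "a < l" for a
    using C''_last_col[OF that] C''_dim by (auto simp: row_sum_def l)
  have row_le: "row_sum C i \<le> r'' a" if "a < l" "i \<in> \<pi> a" for a i
    unfolding r''_max[OF that(1)] using that fin by auto
  \<comment> \<open>Positivity of the last row comes from \<open>C''_off_diag\<close> with
    \<open>a = l - 1\<close>, which differs from every \<open>b < m\<close>.\<close>
  have ex: "\<exists>v. positive_vec v \<and> rooted_vec v \<and> eigenvector C'' v ?s"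
    using C''_off_diag r''_last C''_dim row_C'' unfolding l
    by (intro rooted_eigenvector_exists[of _ m]) (auto simp: less_Suc_eq)
  define idx where "idx i = (THE a. a < l \<and> i \<in> \<pi> a)" for i
  have idx: "idx i = a" if "a < l" "i \<in> \<pi> a" for a i
    unfolding idx_def using that disj by (intro the_equality) auto
  have idx_ex: "\<exists>a<l. i \<in> \<pi> a" if "i < n" for i
    using Un that by blast
  \<comment> \<open>Condition (b) depends on the eigenvector, so \<open>v\<close> is arbitrary here;
    \<open>ex\<close> supplies one for the bound on the spectral radius.\<close>
  have main: "real_spectral_radius C \<le> ?s \<and> (irreducible_mat C \<longrightarrow>
      (real_spectral_radius C = ?s \<longleftrightarrow>
        (\<forall>a<l. \<forall>i\<in>\<pi> a. row_sum C i = r'' a) \<and>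
        (\<forall>a<l. \<forall>b<l. v $ b > v $ (l - 1) \<longrightarrow>
          (\<forall>i\<in>\<pi> a. (\<Sum>j\<in>\<pi> b. C $$ (i, j)) = C'' $$ (a, b)))))"
    if v: "positive_vec v" "rooted_vec v" "eigenvector C'' v ?s" for v
  proof -
    have dim: "dim_vec v = Suc m"
      and eig: "\<And>a. a < l \<Longrightarrow> (\<Sum>b<Suc m. C'' $$ (a, b) * v $ b) = ?s * v $ a"
      using v(3) unfolding eigenvector_iff_sum[OF C''_dim] by (auto simp: l)
    have v_pos: "\<And>a. a < l \<Longrightarrow> 0 < v $ a" and v_ge: "\<And>b. b < m \<Longrightarrow> 0 \<le> v $ b - v $ m"
      using v(1,2) by (auto simp: positive_vec_def rooted_vec_def dim l)
    define x where "x i = v $ idx i" for i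
    \<comment> \<open>Since \<open>x\<close> is constant on parts, \<open>C x\<close> becomes block
      sums against \<open>v\<close>. Splitting off \<open>v $ m\<close> gives the shape of
      \<open>sum_C''\<close>, so the two compare term by term.\<close>
    have sum_C: "(\<Sum>j<n. C $$ (i, j) * x j) =
        (\<Sum>b<m. (\<Sum>j\<in>\<pi> b. C $$ (i, j)) * (v $ b - v $ m)) + row_sum C i * v $ m" for i
    proof -
      have split: "(\<Sum>j<n. f j) = (\<Sum>b<l. \<Sum>j\<in>\<pi> b. f j)" for f :: "nat \<Rightarrow> real"
        unfolding Un[symmetric] using fin disj by (intro sum.UNION_disjoint) auto
      have "(\<Sum>j<n. C $$ (i, j) * x j) = (\<Sum>b<l. (\<Sum>j\<in>\<pi> b. C $$ (i, j)) * v $ b)"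
        unfolding split by (auto simp: sum_distrib_right x_def idx intro!: sum.cong)
      moreover have "row_sum C i = (\<Sum>b<l. \<Sum>j\<in>\<pi> b. C $$ (i, j))"
        using C_dim split by (simp add: row_sum_def)
      ultimately show ?thesis
        by (simp add: l algebra_simps sum_subtractf sum_distrib_left)
    qed
    have sum_C'': "?s * x i =
        (\<Sum>b<m. C'' $$ (a, b) * (v $ b - v $ m)) + r'' a * v $ m" if "a < l" "i \<in> \<pi> a" for a i
      using eig[OF that(1)] idx[OF that] row_C''[OF that(1)]
      unfolding rooted_sum_eq[OF C''_dim[unfolded l]] by (simp add: x_def)
    have c_le: "(\<Sum>j\<in>\<pi> b. C $$ (i, j)) \<le> C'' $$ (a, b)" if "a < l" "i \<in> \<pi> a" "b < m" for a b i
      using C''_ge[of a b i] that by (simp add: l)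
    have vm: "0 < v $ m" using v_pos l by simp
    have x_pos: "0 < x i" if "i < n" for i
      using idx_ex[OF that] idx v_pos by (auto simp: x_def)
    have x_sub: "(\<Sum>j<n. C $$ (i, j) * x j) \<le> ?s * x i" if i: "i < n" for i
    proof -
      obtain a where a: "a < l" "i \<in> \<pi> a" using idx_ex[OF i] by auto
      show ?thesis
        unfolding sum_C sum_C''[OF a]
        by (intro weighted_sum_mono c_le[OF a] v_ge row_le[OF a] vm)
    qed
    have x_eq: "(\<Sum>j<n. C $$ (i, j) * x j) = ?s * x i \<longleftrightarrow>
        row_sum C i = r'' a \<and> (\<forall>b<m. v $ b > v $ m \<longrightarrow> (\<Sum>j\<in>\<pi> b. C $$ (i, j)) = C'' $$ (a, b))"
      if a: "a < l" "i \<in> \<pi> a" for a i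
      unfolding sum_C sum_C''[OF a]
      using weighted_sum_eq_iff[where g = "\<lambda>b. v $ b - v $ m", OF c_le[OF a] v_ge row_le[OF a] vm]
      by simp
    have "(\<forall>i<n. (\<Sum>j<n. C $$ (i, j) * x j) = ?s * x i) \<longleftrightarrow>
        (\<forall>a<l. \<forall>i\<in>\<pi> a. (\<Sum>j<n. C $$ (i, j) * x j) = ?s * x i)"
      using idx_ex part by blast
    also have "\<dots> \<longleftrightarrow> (\<forall>a<l. \<forall>i\<in>\<pi> a. row_sum C i = r'' a \<and>
        (\<forall>b<m. v $ b > v $ m \<longrightarrow> (\<Sum>j\<in>\<pi> b. C $$ (i, j)) = C'' $$ (a, b)))"
      using x_eq by simp
    \<comment> \<open>The additional index \<open>b = l - 1\<close> is vacuous, since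
      \<open>v $ (l - 1)\<close> does not exceed itself.\<close>
    also have "\<dots> \<longleftrightarrow> (\<forall>a<l. \<forall>i\<in>\<pi> a. row_sum C i = r'' a) \<and>
        (\<forall>a<l. \<forall>b<l. v $ b > v $ (l - 1) \<longrightarrow>
          (\<forall>i\<in>\<pi> a. (\<Sum>j\<in>\<pi> b. C $$ (i, j)) = C'' $$ (a, b)))"
      by (auto simp: l less_Suc_eq)
    finally show ?thesis
      using positive_subinvariant_vec[OF C_dim C_nonneg n x_pos x_sub] by blast
  qed
  with ex show ?thesis by blast
qed

end
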